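(* Let $\mu$ be a cardinal such that both $\mu$ and $\log(\mu^+)$ are regular cardinals. Then there is a 0-dimensional Hausdorff space $Y$ such that $\chi(Y)\cdot\operatorname{nw}(Y)\le\mu$, but $Y$ is not the union of $\mu$ subspaces each of weight at most $\mu$.
   Context: $\log(\mu^+)=\min\{\nu: 2^\nu\ge\mu^+\}$. $\chi$ denotes character, $\operatorname{nw}$ network weight, and weight of a subspace refers to its subspace topology. *)

theory Defs
  imports "HOL-Analysis.Analysis"
begin

unbundle cardinal_syntax

(* Set_Algebras also uses this symbol. *)
no_notation elt_set_eq (infix "=o" 50)

(* Cardinals are represented by their cardinal orders and are compared with \<le>o;
   they are determined only up to =o. *)

definition regular_cardinal :: "'a rel \<Rightarrow> bool" where
  "regular_cardinal r \<longleftrightarrow> Cinfinite r \<and> regularCard r"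

(* The minimum ranges over the cardinals carried by the type 'b only. Each use below takes
   a type large enough to realise the minimum over all cardinals. If no cardinal on 'b
   satisfies P, the value is unspecified. *)
definition least_card :: "('b rel \<Rightarrow> bool) \<Rightarrow> 'b rel" where
  "least_card P =
     (SOME \<kappa>. Card_order \<kappa> \<and> P \<kappa> \<and> (\<forall>\<nu>. Card_order \<nu> \<and> P \<nu> \<longrightarrow> \<kappa> \<le>o \<nu>))"

lemma least_card_spec:
  assumes "Card_order r" and "P r"
  shows "Card_order (least_card P)" and "P (least_card P)"
    and "\<And>\<nu>. Card_order \<nu> \<Longrightarrow> P \<nu> \<Longrightarrow> least_card P \<le>o \<nu>"
proof -
  let ?R = "{\<kappa>. Card_order \<kappa> \<and> P \<kappa>}"
  have "\<exists>\<kappa>\<in>?R. \<forall>\<nu>\<in>?R. \<kappa> \<le>o \<nu>"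
    by (rule exists_minim_Card_order) (use assms in auto)
  then have "\<exists>\<kappa>. Card_order \<kappa> \<and> P \<kappa> \<and> (\<forall>\<nu>. Card_order \<nu> \<and> P \<nu> \<longrightarrow> \<kappa> \<le>o \<nu>)"
    by blast
  from someI_ex[OF this]
  show "Card_order (least_card P)" and "P (least_card P)"
    and "\<And>\<nu>. Card_order \<nu> \<Longrightarrow> P \<nu> \<Longrightarrow> least_card P \<le>o \<nu>"
    unfolding least_card_def by blast+
qed

(* log \<kappa> = min {\<nu>. 2^\<nu> \<ge> \<kappa>}; as \<kappa> itself qualifies, it suffices to look for \<nu> on the
   type of \<kappa>. *)
definition clog :: "'b rel \<Rightarrow> 'b rel" where
  "clog \<kappa> = least_card (\<lambda>\<nu>. \<kappa> \<le>o ctwo ^c \<nu>)"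

lemma clog_spec:
  fixes \<kappa> :: "'b rel"
  assumes "Card_order \<kappa>"
  shows "Card_order (clog \<kappa>)" and "\<kappa> \<le>o ctwo ^c clog \<kappa>"
    and "\<And>\<nu> :: 'b rel. Card_order \<nu> \<Longrightarrow> \<kappa> \<le>o ctwo ^c \<nu> \<Longrightarrow> clog \<kappa> \<le>o \<nu>"
proof -
  have "\<kappa> \<le>o ctwo ^c \<kappa>"
    by (rule ordLess_imp_ordLeq) (rule ordLess_ctwo_cexp[OF assms])
  from least_card_spec[where P = "\<lambda>\<nu>. \<kappa> \<le>o ctwo ^c \<nu>", OF assms this]
  show "Card_order (clog \<kappa>)" and "\<kappa> \<le>o ctwo ^c clog \<kappa>"
    and "\<And>\<nu> :: 'b rel. Card_order \<nu> \<Longrightarrow> \<kappa> \<le>o ctwo ^c \<nu> \<Longrightarrow> clog \<kappa> \<le>o \<nu>"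
    unfolding clog_def by blast+
qed

definition is_base :: "'b topology \<Rightarrow> 'b set set \<Rightarrow> bool" where
  "is_base Y \<B> \<longleftrightarrow> (\<forall>V\<in>\<B>. openin Y V) \<and>
     (\<forall>U x. openin Y U \<and> x \<in> U \<longrightarrow> (\<exists>V\<in>\<B>. x \<in> V \<and> V \<subseteq> U))"

definition is_local_base :: "'b topology \<Rightarrow> 'b \<Rightarrow> 'b set set \<Rightarrow> bool" where
  "is_local_base Y x \<B> \<longleftrightarrow> (\<forall>V\<in>\<B>. openin Y V \<and> x \<in> V) \<and>
     (\<forall>U. openin Y U \<and> x \<in> U \<longrightarrow> (\<exists>V\<in>\<B>. V \<subseteq> U))"

definition is_network :: "'b topology \<Rightarrow> 'b set set \<Rightarrow> bool" where
  "is_network Y \<N> \<longleftrightarrow> (\<forall>A\<in>\<N>. A \<subseteq> topspace Y) \<and>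
     (\<forall>U x. openin Y U \<and> x \<in> U \<longrightarrow> (\<exists>A\<in>\<N>. x \<in> A \<and> A \<subseteq> U))"

(* The cardinal functions are not rounded up to \<omega>: finite values are possible, which makes
   no difference when comparing with an infinite cardinal. *)

definition weight :: "'b topology \<Rightarrow> 'b set rel" where
  "weight Y = least_card (\<lambda>\<kappa>. \<exists>\<B>. is_base Y \<B> \<and> |\<B>| =o \<kappa>)"

definition network_weight :: "'b topology \<Rightarrow> 'b set rel" where
  "network_weight Y = least_card (\<lambda>\<kappa>. \<exists>\<N>. is_network Y \<N> \<and> |\<N>| =o \<kappa>)"

definition character_at :: "'b topology \<Rightarrow> 'b \<Rightarrow> 'b set rel" where
  "character_at Y x = least_card (\<lambda>\<kappa>. \<exists>\<B>. is_local_base Y x \<B> \<and> |\<B>| =o \<kappa>)"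

(* the supremum of the characters at the points, as a least upper bound of cardinals *)
definition character :: "'b topology \<Rightarrow> 'b set rel" where
  "character Y = least_card (\<lambda>\<kappa>. \<forall>x\<in>topspace Y. character_at Y x \<le>o \<kappa>)"

lemma weight_spec:
  shows "Card_order (weight Y)" and "\<exists>\<B>. is_base Y \<B> \<and> |\<B>| =o weight Y"
    and "\<And>\<B>. is_base Y \<B> \<Longrightarrow> weight Y \<le>o |\<B>|"
proof -
  have b: "is_base Y {V. openin Y V}"
    unfolding is_base_def by blast
  have ex: "\<exists>\<B>'. is_base Y \<B>' \<and> |\<B>'| =o |\<B>|" if "is_base Y \<B>" for \<B>
    using that card_of_refl by blast
  note s = least_card_spec[where P = "\<lambda>\<kappa>. \<exists>\<B>. is_base Y \<B> \<and> |\<B>| =o \<kappa>",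
      OF card_of_Card_order ex[OF b], folded weight_def]
  show "Card_order (weight Y)" "\<exists>\<B>. is_base Y \<B> \<and> |\<B>| =o weight Y"
    by (fact s)+
  show "weight Y \<le>o |\<B>|" if "is_base Y \<B>" for \<B>
    by (rule s(3)[OF card_of_Card_order ex[OF that]])
qed

lemma network_weight_spec:
  shows "Card_order (network_weight Y)" and "\<exists>\<N>. is_network Y \<N> \<and> |\<N>| =o network_weight Y"
    and "\<And>\<N>. is_network Y \<N> \<Longrightarrow> network_weight Y \<le>o |\<N>|"
proof -
  have b: "is_network Y {V. openin Y V}"
    unfolding is_network_def using openin_subset by blast
  have ex: "\<exists>\<N>'. is_network Y \<N>' \<and> |\<N>'| =o |\<N>|" if "is_network Y \<N>" for \<N>
    using that card_of_refl by blast
  note s = least_card_spec[where P = "\<lambda>\<kappa>. \<exists>\<N>. is_network Y \<N> \<and> |\<N>| =o \<kappa>",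
      OF card_of_Card_order ex[OF b], folded network_weight_def]
  show "Card_order (network_weight Y)" "\<exists>\<N>. is_network Y \<N> \<and> |\<N>| =o network_weight Y"
    by (fact s)+
  show "network_weight Y \<le>o |\<N>|" if "is_network Y \<N>" for \<N>
    by (rule s(3)[OF card_of_Card_order ex[OF that]])
qed

lemma character_at_spec:
  shows "Card_order (character_at Y x)" and "\<exists>\<B>. is_local_base Y x \<B> \<and> |\<B>| =o character_at Y x"
    and "\<And>\<B>. is_local_base Y x \<B> \<Longrightarrow> character_at Y x \<le>o |\<B>|"
proof -
  have b: "is_local_base Y x {V. openin Y V \<and> x \<in> V}"
    unfolding is_local_base_def by blast
  have ex: "\<exists>\<B>'. is_local_base Y x \<B>' \<and> |\<B>'| =o |\<B>|" if "is_local_base Y x \<B>" for \<B>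
    using that card_of_refl by blast
  note s = least_card_spec[where P = "\<lambda>\<kappa>. \<exists>\<B>. is_local_base Y x \<B> \<and> |\<B>| =o \<kappa>",
      OF card_of_Card_order ex[OF b], folded character_at_def]
  show "Card_order (character_at Y x)" "\<exists>\<B>. is_local_base Y x \<B> \<and> |\<B>| =o character_at Y x"
    by (fact s)+
  show "character_at Y x \<le>o |\<B>|" if "is_local_base Y x \<B>" for \<B>
    by (rule s(3)[OF card_of_Card_order ex[OF that]])
qed

lemma character_spec:
  fixes Y :: "'b topology"
  shows "Card_order (character Y)" and "\<forall>x\<in>topspace Y. character_at Y x \<le>o character Y"
    and "\<And>\<kappa> :: 'b set rel. Card_order \<kappa> \<Longrightarrow> \<forall>x\<in>topspace Y. character_at Y x \<le>o \<kappa>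
           \<Longrightarrow> character Y \<le>o \<kappa>"
proof -
  have "\<forall>x\<in>topspace Y. character_at Y x \<le>o |UNIV :: 'b set set|"
    using character_at_spec(1) Card_order_iff_ordLeq_card_of card_of_mono1 ordLeq_transitive
    by (metis subset_UNIV)
  note s = least_card_spec[where P = "\<lambda>\<kappa>. \<forall>x\<in>topspace Y. character_at Y x \<le>o \<kappa>",
      OF card_of_Card_order this, folded character_def]
  show "Card_order (character Y)" "\<forall>x\<in>topspace Y. character_at Y x \<le>o character Y"
    by (fact s)+
  show "character Y \<le>o \<kappa>"
    if "Card_order \<kappa>" "\<forall>x\<in>topspace Y. character_at Y x \<le>o \<kappa>" for \<kappa> :: "'b set rel"
    by (rule s(3)[OF that])
qed

definition zero_dimensional :: "'b topology \<Rightarrow> bool" where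
  "zero_dimensional Y \<longleftrightarrow> (\<exists>\<B>. is_base Y \<B> \<and> (\<forall>V\<in>\<B>. closedin Y V))"

lemma zero_dimensional_iff_dim_le_0: "zero_dimensional Y \<longleftrightarrow> Y dim_le 0"
proof -
  have "zero_dimensional Y \<longleftrightarrow>
      (\<forall>U x. openin Y U \<and> x \<in> U \<longrightarrow> (\<exists>V. closedin Y V \<and> openin Y V \<and> x \<in> V \<and> V \<subseteq> U))"
    (is "_ \<longleftrightarrow> ?R")
  proof
    show ?R if "zero_dimensional Y"
      using that unfolding zero_dimensional_def is_base_def by metis
    show "zero_dimensional Y" if ?R
      unfolding zero_dimensional_def is_base_def
      by (rule exI[of _ "{V. closedin Y V \<and> openin Y V}"]) (use that in blast)
  qed
  also have "\<dots> \<longleftrightarrow> Y dim_le 0"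
    unfolding dimension_le_0_neighbourhood_base_of_clopen
    by (subst open_neighbourhood_base_of) blast+
  finally show ?thesis .
qed

end

theory Submission
  imports Defs
begin

text \<open>Let \<open>\<nu> = log \<mu>\<^sup>+\<close>, so that \<open>2\<close> to any power below \<open>\<nu>\<close> is at most \<open>\<mu>\<close> while \<open>2\<^sup>\<nu> > \<mu>\<close>.
  On the nodes and the branches of the binary tree of height \<open>\<nu>\<close> there is a bow-tie space \<open>Z\<close>: nodes
  are isolated, and a neighbourhood of a branch \<open>x\<close> consists of the branches and nodes that extend an
  initial segment of \<open>x\<close>, without the nodes lying on \<open>x\<close> itself. It has character and network weight
  at most \<open>\<mu>\<close>, but weight greater than \<open>\<mu>\<close>.

  Take \<open>Y = Z\<^sup>\<mu>\<close>. Since \<open>\<mu>\<close> is regular, the partial functions from \<open>\<mu>\<close> to \<open>Z\<close> of size less than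
  \<open>\<mu>\<close> satisfy a Baire category theorem for \<open>\<mu>\<close> dense sets. Hence if \<open>\<mu>\<close> pieces cover \<open>Y\<close>, some piece
  \<open>A\<close> meets every extension of some small partial function \<open>q\<close>. Any coordinate outside the domain
  of \<open>q\<close> then maps the part of \<open>A\<close> extending \<open>q\<close> openly onto \<open>Z\<close>, so the weight of \<open>A\<close> exceeds \<open>\<mu>\<close>.\<close>

subsection \<open>Cardinal bounds\<close>

lemma finite_ordLess_Cinfinite:
  assumes "Cinfinite r" "finite A"
  shows "|A| <o r"
  using assms by (intro Cfinite_ordLess_Cinfinite) (auto simp: cfinite_def Field_card_of card_of_card_order_on)

lemmas finite_Cinfinite_bound = ordLess_imp_ordLeq[OF finite_ordLess_Cinfinite]

text \<open>Finite subsets are sorted by size. A set of size \<open>Suc n\<close> is an element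
  inserted into a set of size \<open>n\<close>, so by induction each size contributes at most
  \<open>r\<close> sets, and there are only countably many sizes.\<close>

lemma Fpow_Cinfinite_bound:
  assumes r: "Cinfinite r" and A: "|A| \<le>o r"
  shows "|Fpow A| \<le>o r"
proof -
  define F where "F n = {X. X \<subseteq> A \<and> finite X \<and> card X = n}" for n
  have "|F n| \<le>o r" for n
  proof (induction n)
    case 0
    have "F 0 = {{}}"
      by (auto simp: F_def)
    then show ?case
      using finite_Cinfinite_bound[OF r, of "{{}}"] by simp
  next
    case (Suc n)
    have "F (Suc n) \<subseteq> (\<lambda>(a, X). insert a X) ` (A \<times> F n)"
    proof
      fix X assume "X \<in> F (Suc n)"
      then obtain a Y where "X = insert a Y" "a \<notin> Y" "card Y = n" "X \<subseteq> A" "finite X"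
        by (auto simp: F_def card_Suc_eq)
      then show "X \<in> (\<lambda>(a, X). insert a X) ` (A \<times> F n)"
        by (auto simp: F_def)
    qed
    moreover have "|A \<times> F n| \<le>o r"
      using Suc A r by (simp add: card_of_Times_ordLeq_infinite_Field cinfinite_def)
    ultimately show ?case
      by (meson card_of_image card_of_mono1 ordLeq_transitive)
  qed
  moreover have "|UNIV :: nat set| \<le>o r"
    using r by (metis cinfinite_def infinite_iff_card_of_nat card_of_Field_ordIso ordLeq_ordIso_trans)
  ultimately have "|\<Union>n. F n| \<le>o r"
    using r by (intro UNION_Cinfinite_bound) auto
  moreover have "Fpow A = (\<Union>n. F n)"
    by (auto simp: Fpow_def F_def)
  ultimately show ?thesis
    by simp
qed

lemma ordLeq_image: "|A| \<le>o r \<Longrightarrow> |f ` A| \<le>o r"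
  using card_of_image ordLeq_transitive by blast

subsection \<open>The bow-tie space\<close>

locale bow_tie =
  fixes r :: "'b rel"
  assumes lin: "Linear_order r" and nonempty: "Field r \<noteq> {}"
begin

text \<open>\<open>Inl x\<close> is the branch with characteristic set \<open>x\<close>; \<open>Inr (m, s)\<close> is the node obtained by
  restricting a branch to the initial segment up to and including \<open>m\<close>, with characteristic set \<open>s\<close>.\<close>

definition carrier :: "('b set + 'b \<times> 'b set) set" where
  "carrier = Inl ` Pow (Field r) \<union> Inr ` (SIGMA m:Field r. Pow (under r m))"

text \<open>The nodes lying on the branch \<open>x\<close> are exactly those with
  \<open>s = x \<inter> under r m\<close>. Because they are left out, the node part depends on
  \<open>x\<close> beyond level \<open>n\<close>, while the branch part depends only on
  \<open>x \<inter> under r n\<close>.\<close>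

definition nbhd :: "'b set \<Rightarrow> 'b \<Rightarrow> ('b set + 'b \<times> 'b set) set" where
  "nbhd x n =
     Inl ` {y. y \<subseteq> Field r \<and> y \<inter> under r n = x \<inter> under r n} \<union>
     Inr ` {(m, s). (n, m) \<in> r \<and> s \<subseteq> under r m \<and> s \<inter> under r n = x \<inter> under r n \<and> s \<noteq> x \<inter> under r m}"

text \<open>Nothing is required at \<open>Inr\<close> points, which makes the nodes
  isolated.\<close>

definition space :: "('b set + 'b \<times> 'b set) topology" where
  "space = topology (\<lambda>U. U \<subseteq> carrier \<and> (\<forall>x. Inl x \<in> U \<longrightarrow> (\<exists>n\<in>Field r. nbhd x n \<subseteq> U)))"

section \<open>Neighbourhoods and open sets of the bow-tie space\<close>

lemma trans_r: "trans r"
  using lin by (simp add: order_on_defs)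

lemma under_mono: "(n, m) \<in> r \<Longrightarrow> under r n \<subseteq> under r m"
  using transD[OF trans_r] unfolding under_def by blast

lemma in_under: "n \<in> Field r \<Longrightarrow> n \<in> under r n"
  using lin unfolding under_def order_on_defs by (auto dest: refl_onD)

lemma total: "n \<in> Field r \<Longrightarrow> m \<in> Field r \<Longrightarrow> m \<notin> under r n \<Longrightarrow> (n, m) \<in> r"
  using lin unfolding under_def order_on_defs total_on_def by (cases "n = m") (auto dest: refl_onD)

lemma Int_under_cong:
  assumes "(n, m) \<in> r" "x \<inter> under r m = y \<inter> under r m"
  shows "x \<inter> under r n = y \<inter> under r n"
proof -
  have "z \<inter> under r n = z \<inter> under r m \<inter> under r n" for z
    using under_mono[OF assms(1)] by blast
  then show ?thesis
    using assms(2) by metis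
qed

lemma Inl_in_nbhd_iff [simp]:
  "Inl y \<in> nbhd x n \<longleftrightarrow> y \<subseteq> Field r \<and> y \<inter> under r n = x \<inter> under r n"
  by (auto simp: nbhd_def)

lemma Inr_in_nbhd_iff [simp]:
  "Inr (m, s) \<in> nbhd x n \<longleftrightarrow>
     (n, m) \<in> r \<and> s \<subseteq> under r m \<and> s \<inter> under r n = x \<inter> under r n \<and> s \<noteq> x \<inter> under r m"
  by (auto simp: nbhd_def)

lemma nbhd_antimono:
  assumes "(n, m) \<in> r"
  shows "nbhd x m \<subseteq> nbhd x n"
proof
  fix z assume z: "z \<in> nbhd x m"
  show "z \<in> nbhd x n"
  proof (cases z)
    case (Inl y)
    then show ?thesis
      using z Int_under_cong[OF assms, of y x] by simp
  next
    case (Inr p)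
    then obtain k s where "z = Inr (k, s)"
      by (cases p) simp
    then show ?thesis
      using z Int_under_cong[OF assms, of s x] transD[OF trans_r assms, of k] by simp
  qed
qed

lemma nbhd_subset_carrier: "nbhd x n \<subseteq> carrier"
  unfolding nbhd_def carrier_def by (intro Un_mono image_mono) (auto intro: FieldI2)

text \<open>\<open>topology\<close> yields the intended open sets once the predicate satisfies
  \<open>istopology\<close>. For intersections, linearity of \<open>r\<close> lets the larger of two
  levels serve both sets.\<close>

lemma openin_space:
  "openin space U \<longleftrightarrow> U \<subseteq> carrier \<and> (\<forall>x. Inl x \<in> U \<longrightarrow> (\<exists>n\<in>Field r. nbhd x n \<subseteq> U))"
proof -
  define P where "P U \<longleftrightarrow> U \<subseteq> carrier \<and> (\<forall>x. Inl x \<in> U \<longrightarrow> (\<exists>n\<in>Field r. nbhd x n \<subseteq> U))" for U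
  have "P (S \<inter> T)" if S: "P S" and T: "P T" for S T
    unfolding P_def
  proof (intro conjI allI impI)
    show "S \<inter> T \<subseteq> carrier"
      using S by (auto simp: P_def)
    fix x assume "Inl x \<in> S \<inter> T"
    then obtain n m where nm: "n \<in> Field r" "m \<in> Field r" "nbhd x n \<subseteq> S" "nbhd x m \<subseteq> T"
      using S T unfolding P_def by (meson IntD1 IntD2)
    then have "(n, m) \<in> r \<or> (m, n) \<in> r"
      using total by (auto simp: under_def)
    then show "\<exists>n\<in>Field r. nbhd x n \<subseteq> S \<inter> T"
    proof
      assume "(n, m) \<in> r"
      then show ?thesis
        using nm nbhd_antimono[of n m x] by (intro bexI[of _ m]) auto
    next
      assume "(m, n) \<in> r"
      then show ?thesis
        using nm nbhd_antimono[of m n x] by (intro bexI[of _ n]) auto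
    qed
  qed
  moreover have "P (\<Union>\<K>)" if \<K>: "\<forall>S\<in>\<K>. P S" for \<K>
    unfolding P_def
  proof (intro conjI allI impI)
    show "\<Union>\<K> \<subseteq> carrier"
      using \<K> by (intro Union_least) (simp add: P_def)
    fix x assume "Inl x \<in> \<Union>\<K>"
    then obtain S where "S \<in> \<K>" "Inl x \<in> S"
      by blast
    then show "\<exists>n\<in>Field r. nbhd x n \<subseteq> \<Union>\<K>"
      using \<K> unfolding P_def by (meson Union_upper subset_trans)
  qed
  ultimately have "istopology P"
    by (simp add: istopology_def)
  moreover have "space = topology P"
    by (simp add: space_def P_def [abs_def])
  ultimately show ?thesis
    by (simp add: P_def)
qed

lemma topspace_space: "topspace space = carrier"
proof -
  have "openin space carrier"
    using nbhd_subset_carrier nonempty by (auto simp: openin_space)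
  then show ?thesis
    by (metis openin_space openin_subset openin_topspace subset_antisym)
qed

text \<open>The hole that \<open>nbhd x n\<close> has along \<open>x\<close> is avoided by going up
  to a level \<open>m\<close> where the two branches differ: every node of \<open>nbhd y m\<close>
  agrees with \<open>y\<close> at \<open>m\<close>, so it cannot lie on \<open>x\<close>.\<close>

lemma nbhd_inside:
  assumes "Inl y \<in> nbhd x n" "y \<noteq> x" "x \<subseteq> Field r" "n \<in> Field r"
  shows "\<exists>m\<in>Field r. nbhd y m \<subseteq> nbhd x n"
proof -
  have y: "y \<subseteq> Field r" "y \<inter> under r n = x \<inter> under r n"
    using assms by (auto simp: nbhd_def)
  obtain m where m: "m \<in> Field r" "m \<in> x \<longleftrightarrow> m \<notin> y"
    using assms y by blast
  then have nm: "(n, m) \<in> r"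
    using total[OF assms(4), of m] y by blast
  have "nbhd y m \<subseteq> nbhd x n"
  proof
    fix z assume z: "z \<in> nbhd y m"
    then have "z \<in> nbhd y n"
      using nbhd_antimono[OF nm] by blast
    moreover have "s \<noteq> x \<inter> under r k" if "z = Inr (k, s)" for k s
    proof
      assume s: "s = x \<inter> under r k"
      have "(m, k) \<in> r" "s \<inter> under r m = y \<inter> under r m"
        using z that by (auto simp: nbhd_def)
      then show False
        using s under_mono m in_under[OF m(1)] by blast
    qed
    ultimately show "z \<in> nbhd x n"
      using y(2) by (auto simp: nbhd_def)
  qed
  then show ?thesis
    using m by blast
qed

lemma openin_nbhd:
  assumes "x \<subseteq> Field r" "n \<in> Field r"
  shows "openin space (nbhd x n)"
proof -
  have "\<exists>m\<in>Field r. nbhd y m \<subseteq> nbhd x n" if "Inl y \<in> nbhd x n" for y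
    using nbhd_inside[OF that _ assms] assms(2) by (cases "y = x") blast+
  then show ?thesis
    using nbhd_subset_carrier by (simp add: openin_space)
qed

lemma closedin_nbhd:
  assumes "x \<subseteq> Field r" "n \<in> Field r"
  shows "closedin space (nbhd x n)"
proof -
  \<comment> \<open>A branch outside \<open>nbhd x n\<close> differs from \<open>x\<close> at or
    below \<open>n\<close>, so the two neighbourhoods at the same level \<open>n\<close> have
    nothing in common.\<close>
  have "nbhd y n \<inter> nbhd x n = {}" if "Inl y \<in> carrier - nbhd x n" for y
    using that by (auto simp: nbhd_def carrier_def)
  then have "openin space (carrier - nbhd x n)"
    unfolding openin_space using nbhd_subset_carrier[of _ n] assms(2)
    by (intro conjI allI impI bexI[of _ n]) blast+
  then show ?thesis
    using nbhd_subset_carrier by (simp add: closedin_def topspace_space)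
qed

text \<open>At its own level a node could only belong by agreeing with \<open>x\<close> all the way,
  but then it lies on \<open>x\<close> and has been removed. This is what makes singletons of nodes
  closed.\<close>

lemma node_notin_nbhd: "Inr (m, s) \<notin> nbhd x m"
proof
  assume "Inr (m, s) \<in> nbhd x m"
  then have "s \<inter> under r m = x \<inter> under r m" "s \<subseteq> under r m" "s \<noteq> x \<inter> under r m"
    by (simp_all add: nbhd_def image_iff)
  then show False
    by (simp add: inf.absorb1)
qed

lemma clopen_node:
  assumes "Inr p \<in> carrier"
  shows "openin space {Inr p}" "closedin space {Inr p}"
proof -
  show "openin space {Inr p}"
    using assms by (auto simp: openin_space)
  obtain m s where p: "p = (m, s)" "m \<in> Field r"
    using assms by (auto simp: carrier_def)
  have "openin space (carrier - {Inr p})"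
    unfolding openin_space
  proof (intro conjI allI impI)
    fix x
    have "nbhd x m \<subseteq> carrier - {Inr p}"
      using node_notin_nbhd nbhd_subset_carrier p(1) by fastforce
    then show "\<exists>n\<in>Field r. nbhd x n \<subseteq> carrier - {Inr p}"
      using p(2) by blast
  qed simp
  then show "closedin space {Inr p}"
    using assms by (simp add: closedin_def topspace_space)
qed

section \<open>Separation in the bow-tie space\<close>

lemma carrier_cases:
  assumes "z \<in> carrier"
  obtains x where "z = Inl x" "x \<subseteq> Field r" | p where "z = Inr p"
  using assms unfolding carrier_def by (cases z) blast+

lemma clopen_base:
  assumes "openin space U" "z \<in> U"
  shows "\<exists>V. openin space V \<and> closedin space V \<and> z \<in> V \<and> V \<subseteq> U"
proof -
  have "z \<in> carrier"
    using assms openin_subset topspace_space by blast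
  then show ?thesis
  proof (cases rule: carrier_cases)
    case (1 x)
    then obtain n where "n \<in> Field r" "nbhd x n \<subseteq> U"
      using assms by (auto simp: openin_space)
    then show ?thesis
      using openin_nbhd closedin_nbhd 1 by (intro exI[of _ "nbhd x n"]) simp
  next
    case (2 p)
    then show ?thesis
      using clopen_node[of p] \<open>z \<in> carrier\<close> assms(2) by (intro exI[of _ "{z}"]) auto
  qed
qed

lemma Hausdorff: "Hausdorff_space space"
  unfolding Hausdorff_space_def topspace_space
proof (intro allI impI, elim conjE)
  fix z w :: "'b set + 'b \<times> 'b set" assume zw: "z \<in> carrier" "w \<in> carrier" "z \<noteq> w"
  \<comment> \<open>A clopen set containing exactly one of the points suffices, since its complement
    is a neighbourhood of the other.\<close>
  have "\<exists>U. openin space U \<and> closedin space U \<and> (z \<in> U \<longleftrightarrow> w \<notin> U)"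
  proof (cases "\<exists>p. z = Inr p \<or> w = Inr p")
    case True
    then have "openin space {z} \<and> closedin space {z} \<or> openin space {w} \<and> closedin space {w}"
      using clopen_node zw by blast
    then show ?thesis
      using zw(3) by blast
  next
    case False
    then obtain x y where xy: "z = Inl x" "w = Inl y" "x \<subseteq> Field r" "y \<subseteq> Field r"
      using zw(1,2) by (auto simp: carrier_def)
    then obtain m where m: "m \<in> Field r" "m \<in> x \<longleftrightarrow> m \<notin> y"
      using zw(3) by blast
    have "Inl y \<notin> nbhd x m"
      using in_under[OF m(1)] m(2) by (auto simp: nbhd_def)
    then show ?thesis
      using openin_nbhd closedin_nbhd xy m(1) by (intro exI[of _ "nbhd x m"]) simp
  qed
  then obtain U where U: "openin space U" "openin space (carrier - U)" "z \<in> U \<longleftrightarrow> w \<notin> U"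
    by (auto simp: closedin_def topspace_space)
  show "\<exists>U V. openin space U \<and> openin space V \<and> z \<in> U \<and> w \<in> V \<and> disjnt U V"
  proof (cases "z \<in> U")
    case True
    then show ?thesis
      using U zw by (intro exI[of _ U] exI[of _ "carrier - U"]) (auto simp: disjnt_def)
  next
    case False
    then show ?thesis
      using U zw by (intro exI[of _ "carrier - U"] exI[of _ U]) (auto simp: disjnt_def)
  qed
qed

section \<open>Character, network weight and weight of the bow-tie space\<close>

lemma local_base_le:
  assumes \<mu>: "Cinfinite \<mu>" and F: "|Field r| \<le>o \<mu>" and z: "z \<in> carrier"
  shows "\<exists>\<B>. is_local_base space z \<B> \<and> |\<B>| \<le>o \<mu>"
  using z
proof (cases rule: carrier_cases)
  case (1 x)
  have "is_local_base space z (nbhd x ` Field r)"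
    unfolding is_local_base_def 1 using openin_nbhd 1 by (auto simp: openin_space)
  then show ?thesis
    using F ordLeq_image by blast
next
  case (2 p)
  have "is_local_base space z {{z}}"
    unfolding is_local_base_def using clopen_node z 2 by auto
  moreover have "|{{z}}| \<le>o \<mu>"
    using finite_Cinfinite_bound[OF \<mu>, of "{{z}}"] by simp
  ultimately show ?thesis
    by blast
qed

lemma nodes_le:
  assumes \<mu>: "Cinfinite \<mu>" and F: "|Field r| \<le>o \<mu>"
    and P: "\<And>n. n \<in> Field r \<Longrightarrow> |Pow (under r n)| \<le>o \<mu>"
  shows "|SIGMA m:Field r. Pow (under r m)| \<le>o \<mu>"
  using assms by (intro card_of_Sigma_ordLeq_infinite_Field) (auto simp: cinfinite_def)

text \<open>Members of a network need not be open, so a branch can be surrounded by branches alone.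
  Such a set \<open>C n s\<close> involves no hole along a particular branch and is indexed by a
  node \<open>(n, s)\<close>; hence there are no more of them than nodes.\<close>

lemma network_le:
  assumes \<mu>: "Cinfinite \<mu>" and F: "|Field r| \<le>o \<mu>"
    and P: "\<And>n. n \<in> Field r \<Longrightarrow> |Pow (under r n)| \<le>o \<mu>"
  shows "\<exists>\<N>. is_network space \<N> \<and> |\<N>| \<le>o \<mu>"
proof -
  let ?N = "SIGMA m:Field r. Pow (under r m)"
  define C :: "'b \<Rightarrow> 'b set \<Rightarrow> ('b set + 'b \<times> 'b set) set"
    where "C n s = Inl ` {y. y \<subseteq> Field r \<and> y \<inter> under r n = s}" for n s
  let ?\<N> = "(\<lambda>p. {Inr p}) ` ?N \<union> (\<lambda>(n, s). C n s) ` ?N"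
  have "is_network space ?\<N>"
    unfolding is_network_def
  proof (intro conjI ballI allI impI)
    show "A \<subseteq> topspace space" if "A \<in> ?\<N>" for A
      using that by (auto simp: topspace_space carrier_def C_def)
    fix U z assume "openin space U \<and> z \<in> U"
    then have U: "openin space U" "z \<in> U" "z \<in> carrier"
      using openin_subset topspace_space by blast+
    show "\<exists>A\<in>?\<N>. z \<in> A \<and> A \<subseteq> U"
      using U(3)
    proof (cases rule: carrier_cases)
      case (1 x)
      then obtain n where n: "n \<in> Field r" "nbhd x n \<subseteq> U"
        using U by (auto simp: openin_space)
      have "C n (x \<inter> under r n) \<in> (\<lambda>(n, s). C n s) ` ?N"
        using n(1) by (intro image_eqI[of _ _ "(n, x \<inter> under r n)"]) auto
      moreover have "z \<in> C n (x \<inter> under r n)" "C n (x \<inter> under r n) \<subseteq> nbhd x n"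
        using 1 by (auto simp: nbhd_def C_def)
      ultimately show ?thesis
        using n(2) by (intro bexI[of _ "C n (x \<inter> under r n)"]) auto
    next
      case (2 p)
      then show ?thesis
        using U by (intro bexI[of _ "{z}"]) (auto simp: carrier_def)
    qed
  qed
  moreover have "|?\<N>| \<le>o \<mu>"
    using nodes_le[OF assms] \<mu> by (intro Un_Cinfinite_bound ordLeq_image)
  ultimately show ?thesis
    by blast
qed

text \<open>If two points share a base element inside their neighbourhoods and agree up to a level at
  which it contains a neighbourhood of one of them, then the node where they split lies directly
  above one point but is seen by the other.\<close>

lemma weight_gt:
  assumes \<mu>: "Cinfinite \<mu>" and F: "|Field r| \<le>o \<mu>"
    and P: "\<And>n. n \<in> Field r \<Longrightarrow> |Pow (under r n)| \<le>o \<mu>"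
    and big: "\<mu> <o |Pow (Field r)|"
    and \<B>: "is_base space \<B>"
  shows "\<not> |\<B>| \<le>o \<mu>"
proof
  assume le: "|\<B>| \<le>o \<mu>"
  let ?N = "SIGMA m:Field r. Pow (under r m)"
  \<comment> \<open>The choice of \<open>n0\<close> is arbitrary: what matters is that
    \<open>nbhd x n0\<close> is an open neighbourhood of \<open>Inl x\<close> omitting every node on
    \<open>x\<close> from level \<open>n0\<close> upwards.\<close>
  obtain n0 where n0: "n0 \<in> Field r"
    using nonempty by blast
  have "\<exists>B n. B \<in> \<B> \<and> Inl x \<in> B \<and> B \<subseteq> nbhd x n0 \<and> n \<in> Field r \<and> nbhd x n \<subseteq> B"
    if x: "x \<in> Pow (Field r)" for x
  proof -
    have "openin space (nbhd x n0)" "Inl x \<in> nbhd x n0"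
      using x n0 openin_nbhd by auto
    then obtain B where B: "B \<in> \<B>" "Inl x \<in> B" "B \<subseteq> nbhd x n0"
      using \<B> unfolding is_base_def by meson
    then have "openin space B"
      using \<B> by (auto simp: is_base_def)
    then obtain n where "n \<in> Field r" "nbhd x n \<subseteq> B"
      using B(2) by (auto simp: openin_space)
    then show ?thesis
      using B by blast
  qed
  then obtain B n where Bn: "\<And>x. x \<in> Pow (Field r) \<Longrightarrow>
      B x \<in> \<B> \<and> Inl x \<in> B x \<and> B x \<subseteq> nbhd x n0 \<and> n x \<in> Field r \<and> nbhd x (n x) \<subseteq> B x"
    by metis
  \<comment> \<open>\<open>h\<close> takes at most \<mu> values on more than \<mu> branches, so two
    branches share the base element, the level and the initial segment up to that level.\<close>
  define h where "h x = (B x, n x, x \<inter> under r (n x))" for x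
  have sub: "h ` Pow (Field r) \<subseteq> \<B> \<times> ?N"
    using Bn by (auto simp: h_def)
  have "\<not> inj_on h (Pow (Field r))"
  proof
    assume "inj_on h (Pow (Field r))"
    then have "|Pow (Field r)| \<le>o |\<B> \<times> ?N|"
      using sub card_of_ordLeq by blast
    moreover have "|\<B> \<times> ?N| \<le>o \<mu>"
      using le nodes_le[OF \<mu> F P] \<mu>
      by (intro card_of_Times_ordLeq_infinite_Field) (auto simp: cinfinite_def)
    ultimately have "|Pow (Field r)| \<le>o \<mu>"
      by (rule ordLeq_transitive)
    then show False
      using big not_ordLess_ordLeq by blast
  qed
  then obtain x y where "x \<in> Pow (Field r)" "y \<in> Pow (Field r)" "x \<noteq> y" "h x = h y"
    unfolding inj_on_def by blast
  then have xy: "x \<subseteq> Field r" "y \<subseteq> Field r" "x \<noteq> y" "B x = B y"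
    "x \<inter> under r (n x) = y \<inter> under r (n x)" "n x = n y"
    by (auto simp: h_def)
  obtain m where m: "m \<in> Field r" "m \<in> x \<longleftrightarrow> m \<notin> y"
    using xy(1-3) by blast
  have x: "n x \<in> Field r" "B x \<subseteq> nbhd x n0" and y: "nbhd y (n y) \<subseteq> B y"
    using Bn[of x] Bn[of y] xy(1,2) by simp_all
  have nm: "(n x, m) \<in> r"
    using total[OF x(1) m(1)] m(2) xy(5) by blast
  have "x \<inter> under r m \<noteq> y \<inter> under r m"
    using m in_under by blast
  moreover have "x \<inter> under r m \<inter> under r (n x) = y \<inter> under r (n x)"
    using under_mono[OF nm] xy(5) by blast
  ultimately have "Inr (m, x \<inter> under r m) \<in> nbhd y (n y)"
    using nm xy(6) by simp
  then have "Inr (m, x \<inter> under r m) \<in> nbhd x n0"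
    using x(2) y xy(4) by blast
  then show False
    by simp
qed

end

subsection \<open>Powers of a space\<close>

text \<open>Constraints form a set of pairs, and the constraining sets are arbitrary. Finite
  constraint sets can thus be counted with \<open>Fpow\<close>, and the same notion serves bases and
  networks.\<close>

definition cylinder :: "'i set \<Rightarrow> 'z topology \<Rightarrow> ('i \<times> 'z set) set \<Rightarrow> ('i \<Rightarrow> 'z) set" where
  "cylinder I Z F = {c \<in> I \<rightarrow>\<^sub>E topspace Z. \<forall>(l, N)\<in>F. c l \<in> N}"

abbreviation power_space :: "'i set \<Rightarrow> 'z topology \<Rightarrow> ('i \<Rightarrow> 'z) topology" where
  "power_space I Z \<equiv> product_topology (\<lambda>_. Z) I"

text \<open>Only the finitely many coordinates restricted by a basic box need refining. The family
  \<open>L\<close> may consist of local bases at the coordinates of \<open>a\<close>, of a network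
  or of a base, so one argument serves all three.\<close>

lemma box_refine:
  assumes W: "openin (power_space I Z) W" "a \<in> W"
    and L: "\<And>l V. l \<in> I \<Longrightarrow> openin Z V \<Longrightarrow> a l \<in> V \<Longrightarrow> \<exists>N\<in>L l. a l \<in> N \<and> N \<subseteq> V"
  shows "\<exists>F\<in>Fpow (Sigma I L). a \<in> cylinder I Z F \<and> cylinder I Z F \<subseteq> W"
proof -
  obtain U where U: "finite {i \<in> I. U i \<noteq> topspace Z}" "\<forall>i\<in>I. openin Z (U i)"
      "a \<in> Pi\<^sub>E I U" "Pi\<^sub>E I U \<subseteq> W"
    using W unfolding openin_product_topology_alt by meson
  let ?J = "{i \<in> I. U i \<noteq> topspace Z}"
  have "\<exists>N. N \<in> L l \<and> a l \<in> N \<and> N \<subseteq> U l" if "l \<in> ?J" for l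
    using L[of l "U l"] U(2) PiE_mem[OF U(3), of l] that by blast
  then obtain N where N: "\<And>l. l \<in> ?J \<Longrightarrow> N l \<in> L l \<and> a l \<in> N l \<and> N l \<subseteq> U l"
    by metis
  define F where "F = (\<lambda>l. (l, N l)) ` ?J"
  have "F \<in> Fpow (Sigma I L)"
    using U(1) N by (auto simp: Fpow_def F_def)
  moreover have "a \<in> I \<rightarrow>\<^sub>E topspace Z"
    using openin_subset[OF W(1)] W(2) by auto
  then have "a \<in> cylinder I Z F"
    using N by (auto simp: cylinder_def F_def)
  moreover have "cylinder I Z F \<subseteq> Pi\<^sub>E I U"
  proof
    fix c assume c: "c \<in> cylinder I Z F"
    have "c l \<in> U l" if "l \<in> I" for l
    proof (cases "l \<in> ?J")
      case True
      then have "c l \<in> N l"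
        using c by (auto simp: cylinder_def F_def)
      then show ?thesis
        using N[OF True] by blast
    next
      case False
      then show ?thesis
        using that c by (auto simp: cylinder_def)
    qed
    then show "c \<in> Pi\<^sub>E I U"
      using c by (auto simp: cylinder_def PiE_iff)
  qed
  ultimately show ?thesis
    using U(4) by blast
qed

lemma box_insert:
  "cylinder I Z (insert (l, N) F) = {c \<in> topspace (power_space I Z). c l \<in> N} \<inter> cylinder I Z F"
  by (auto simp: cylinder_def)

lemma openin_box:
  assumes "finite F" "\<And>l N. (l, N) \<in> F \<Longrightarrow> l \<in> I \<and> openin Z N"
  shows "openin (power_space I Z) (cylinder I Z F)"
  using assms
proof (induction F)
  case empty
  have "cylinder I Z {} = topspace (power_space I Z)"
    by (auto simp: cylinder_def)
  then show ?case
    by (metis openin_topspace)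
next
  case (insert p F)
  obtain l N where p: "p = (l, N)"
    by (cases p)
  have "openin (power_space I Z) {c \<in> topspace (power_space I Z). c l \<in> N}"
    using insert.prems p
    by (intro openin_continuous_map_preimage[OF continuous_map_product_projection]) auto
  then show ?case
    unfolding p box_insert using insert by (intro openin_Int) auto
qed

lemma closedin_box:
  assumes "finite F" "\<And>l N. (l, N) \<in> F \<Longrightarrow> l \<in> I \<and> closedin Z N"
  shows "closedin (power_space I Z) (cylinder I Z F)"
  using assms
proof (induction F)
  case empty
  have "cylinder I Z {} = topspace (power_space I Z)"
    by (auto simp: cylinder_def)
  then show ?case
    by (metis closedin_topspace)
next
  case (insert p F)
  obtain l N where p: "p = (l, N)"
    by (cases p)
  have "closedin (power_space I Z) {c \<in> topspace (power_space I Z). c l \<in> N}"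
    using insert.prems p
    by (intro closedin_continuous_map_preimage[OF continuous_map_product_projection]) auto
  then show ?case
    unfolding p box_insert using insert by (intro closedin_Int) auto
qed

section \<open>Local bases, networks and clopen bases of powers\<close>

lemma boxes_le:
  assumes "Cinfinite \<mu>" "|I| \<le>o \<mu>" "\<And>l. l \<in> I \<Longrightarrow> |L l| \<le>o \<mu>"
  shows "|cylinder I Z ` Fpow (Sigma I L)| \<le>o \<mu>"
proof -
  have "|Sigma I L| \<le>o \<mu>"
    using assms by (intro card_of_Sigma_ordLeq_infinite_Field) (auto simp: cinfinite_def)
  then show ?thesis
    by (intro ordLeq_image Fpow_Cinfinite_bound assms(1))
qed

lemma power_space_local_base:
  assumes \<mu>: "Cinfinite \<mu>" "|I| \<le>o \<mu>"
    and Z: "\<And>z. z \<in> topspace Z \<Longrightarrow> \<exists>\<B>. is_local_base Z z \<B> \<and> |\<B>| \<le>o \<mu>"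
    and a: "a \<in> topspace (power_space I Z)"
  shows "\<exists>\<B>. is_local_base (power_space I Z) a \<B> \<and> |\<B>| \<le>o \<mu>"
proof -
  have "\<forall>l\<in>I. \<exists>\<B>. is_local_base Z (a l) \<B> \<and> |\<B>| \<le>o \<mu>"
    using a Z by (auto simp: PiE_iff)
  then obtain L where L: "\<And>l. l \<in> I \<Longrightarrow> is_local_base Z (a l) (L l) \<and> |L l| \<le>o \<mu>"
    by metis
  have "is_local_base (power_space I Z) a (cylinder I Z ` Fpow (Sigma I L))"
    unfolding is_local_base_def
  proof (intro conjI ballI allI impI)
    fix V assume "V \<in> cylinder I Z ` Fpow (Sigma I L)"
    then obtain F where F: "V = cylinder I Z F" "F \<subseteq> Sigma I L" "finite F"
      by (auto simp: Fpow_def)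
    have FL: "l \<in> I \<and> openin Z N \<and> a l \<in> N" if "(l, N) \<in> F" for l N
      using F(2) that L[of l] by (auto simp: is_local_base_def)
    then show "openin (power_space I Z) V"
      unfolding F(1) by (intro openin_box F(3)) auto
    show "a \<in> V"
      using FL a by (auto simp: F(1) cylinder_def)
  next
    fix U assume U: "openin (power_space I Z) U \<and> a \<in> U"
    have "\<exists>N\<in>L l. a l \<in> N \<and> N \<subseteq> V" if "l \<in> I" "openin Z V" "a l \<in> V" for l V
      using L[OF that(1)] that(2,3) unfolding is_local_base_def by blast
    then show "\<exists>V\<in>cylinder I Z ` Fpow (Sigma I L). V \<subseteq> U"
      using box_refine[of Z I U a L] U by blast
  qed
  moreover have "|cylinder I Z ` Fpow (Sigma I L)| \<le>o \<mu>"
    using L by (intro boxes_le \<mu>) auto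
  ultimately show ?thesis
    by blast
qed

lemma power_space_network:
  assumes \<mu>: "Cinfinite \<mu>" "|I| \<le>o \<mu>"
    and Z: "is_network Z \<N>" "|\<N>| \<le>o \<mu>"
  shows "\<exists>\<M>. is_network (power_space I Z) \<M> \<and> |\<M>| \<le>o \<mu>"
proof -
  have "is_network (power_space I Z) (cylinder I Z ` Fpow (Sigma I (\<lambda>_. \<N>)))"
    unfolding is_network_def
  proof (intro conjI ballI allI impI)
    show "A \<subseteq> topspace (power_space I Z)" if "A \<in> cylinder I Z ` Fpow (Sigma I (\<lambda>_. \<N>))" for A
      using that by (auto simp: cylinder_def)
    fix U a assume U: "openin (power_space I Z) U \<and> a \<in> U"
    have "\<exists>N\<in>\<N>. a l \<in> N \<and> N \<subseteq> V" if "openin Z V" "a l \<in> V" for l V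
      using Z(1) that unfolding is_network_def by blast
    then show "\<exists>A\<in>cylinder I Z ` Fpow (Sigma I (\<lambda>_. \<N>)). a \<in> A \<and> A \<subseteq> U"
      using box_refine[of Z I U a "\<lambda>_. \<N>"] U by blast
  qed
  moreover have "|cylinder I Z ` Fpow (Sigma I (\<lambda>_. \<N>))| \<le>o \<mu>"
    using Z by (intro boxes_le \<mu>) auto
  ultimately show ?thesis
    by blast
qed

lemma power_space_zero_dimensional:
  assumes Z: "zero_dimensional Z"
  shows "zero_dimensional (power_space I Z)"
proof -
  obtain \<B> where \<B>: "is_base Z \<B>" "\<And>V. V \<in> \<B> \<Longrightarrow> closedin Z V"
    using Z by (auto simp: zero_dimensional_def)
  have clopen: "openin (power_space I Z) (cylinder I Z F) \<and> closedin (power_space I Z) (cylinder I Z F)"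
    if "F \<in> Fpow (Sigma I (\<lambda>_. \<B>))" for F
  proof -
    have "finite F" "\<And>l N. (l, N) \<in> F \<Longrightarrow> l \<in> I \<and> openin Z N \<and> closedin Z N"
      using that \<B> by (auto simp: Fpow_def is_base_def)
    then show ?thesis
      using openin_box closedin_box by metis
  qed
  have "is_base (power_space I Z) (cylinder I Z ` Fpow (Sigma I (\<lambda>_. \<B>)))"
    unfolding is_base_def
  proof (intro conjI ballI allI impI)
    show "openin (power_space I Z) V" if "V \<in> cylinder I Z ` Fpow (Sigma I (\<lambda>_. \<B>))" for V
      using that clopen by blast
    fix U a assume U: "openin (power_space I Z) U \<and> a \<in> U"
    have "\<exists>N\<in>\<B>. a l \<in> N \<and> N \<subseteq> V" if "openin Z V" "a l \<in> V" for l V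
      using \<B>(1) that unfolding is_base_def by blast
    then show "\<exists>V\<in>cylinder I Z ` Fpow (Sigma I (\<lambda>_. \<B>)). a \<in> V \<and> V \<subseteq> U"
      using box_refine[of Z I U a "\<lambda>_. \<B>"] U by blast
  qed
  then show ?thesis
    unfolding zero_dimensional_def using clopen by blast
qed

subsection \<open>Baire category\<close>

text \<open>Partial functions are kept as graphs, so that extension is inclusion and the limit of a
  chain is its union.\<close>

definition small_partial :: "'i rel \<Rightarrow> 'z set \<Rightarrow> ('i \<times> 'z) set \<Rightarrow> bool" where
  "small_partial \<mu> S p \<longleftrightarrow> p \<subseteq> Field \<mu> \<times> S \<and> single_valued p \<and> |p| <o \<mu>"

definition extends :: "('i \<Rightarrow> 'z) \<Rightarrow> ('i \<times> 'z) set \<Rightarrow> bool" where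
  "extends a p \<longleftrightarrow> (\<forall>(j, z)\<in>p. a j = z)"

lemma extendsD: "extends a p \<Longrightarrow> (j, z) \<in> p \<Longrightarrow> a j = z"
  by (auto simp: extends_def)

lemma Card_order_cases:
  assumes "Card_order \<mu>" "j \<in> Field \<mu>" "k \<in> Field \<mu>"
  shows "j = k \<or> j \<in> underS \<mu> k \<or> k \<in> underS \<mu> j"
proof -
  have "total_on (Field \<mu>) \<mu>"
    using assms(1) by (simp add: card_order_on_def order_on_defs)
  then show ?thesis
    using assms(2,3) unfolding total_on_def underS_def by blast
qed

text \<open>Otherwise every small partial function could be extended so as to avoid any given piece.
  Doing this for piece \<open>i\<close> at stage \<open>i\<close> of a recursion along \<mu>
  produces a chain, and a total function extending the whole chain lies in no piece.\<close>

lemma exists_somewhere_dense_piece: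
  assumes \<mu>: "Cinfinite \<mu>" "regularCard \<mu>" and S: "S \<noteq> {}"
    and cover: "Field \<mu> \<rightarrow>\<^sub>E S \<subseteq> (\<Union>i\<in>Field \<mu>. A i)"
  shows "\<exists>i\<in>Field \<mu>. \<exists>q. small_partial \<mu> S q \<and>
           (\<forall>p. small_partial \<mu> S p \<and> q \<subseteq> p \<longrightarrow> (\<exists>a\<in>A i. extends a p))"
proof (rule ccontr)
  assume "\<not> ?thesis"
  then have ex: "\<exists>p. small_partial \<mu> S p \<and> q \<subseteq> p \<and> (\<forall>a\<in>A i. \<not> extends a p)"
    if "i \<in> Field \<mu>" "small_partial \<mu> S q" for i q
    using that by meson
  define E where "E i q = (SOME p. small_partial \<mu> S p \<and> q \<subseteq> p \<and> (\<forall>a\<in>A i. \<not> extends a p))" for i q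
  have E: "small_partial \<mu> S (E i q) \<and> q \<subseteq> E i q \<and> (\<forall>a\<in>A i. \<not> extends a (E i q))"
    if "i \<in> Field \<mu>" "small_partial \<mu> S q" for i q
    unfolding E_def by (rule someI_ex[OF ex[OF that]])
  \<comment> \<open>Unsuitable arguments are returned unchanged, so the recursion is defined
    everywhere and increasing before its stages are known to be small.\<close>
  define E' where "E' i q = (if i \<in> Field \<mu> \<and> small_partial \<mu> S q then E i q else q)" for i q
  have E'_ge: "q \<subseteq> E' i q" for i q
    using E by (auto simp: E'_def)
  have wo: "wo_rel \<mu>"
    using \<mu>(1) by (simp add: wo_rel_def card_order_on_def)
  \<comment> \<open>Stage \<open>i\<close> uses only the union of the stages strictly below
    \<open>i\<close>, which is the admissibility condition for well-founded recursion.\<close>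
  define H where "H = (\<lambda>p i. E' i (\<Union>j\<in>underS \<mu> i. p j))"
  define p where "p = wo_rel.worec \<mu> H"
  define q where "q i = (\<Union>j\<in>underS \<mu> i. p j)" for i
  have "wo_rel.adm_wo \<mu> H"
    by (auto simp: wo_rel.adm_wo_def[OF wo] H_def)
  then have "p = H p"
    unfolding p_def by (rule wo_rel.worec_fixpoint[OF wo])
  then have p_eq: "p i = E' i (q i)" for i
    by (metis H_def q_def)
  have mono: "p j \<subseteq> p i" if "j \<in> underS \<mu> i" for i j
  proof -
    have "p j \<subseteq> q i"
      using that by (auto simp: q_def)
    then show ?thesis
      using E'_ge[of "q i" i] by (simp add: p_eq[of i])
  qed
  have q_small: "small_partial \<mu> S (q i)"
    if i: "i \<in> Field \<mu>" and IH: "\<And>j. j \<in> underS \<mu> i \<Longrightarrow> small_partial \<mu> S (p j)" for i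
  proof -
    have "single_valued (q i)"
    proof (rule single_valuedI)
      fix x y z assume "(x, y) \<in> q i" "(x, z) \<in> q i"
      then obtain j k where jk: "j \<in> underS \<mu> i" "k \<in> underS \<mu> i" "(x, y) \<in> p j" "(x, z) \<in> p k"
        by (auto simp: q_def)
      then have "j \<in> Field \<mu>" "k \<in> Field \<mu>"
        by (auto simp: underS_def Field_def)
      then have "\<exists>l\<in>{j, k}. (x, y) \<in> p l \<and> (x, z) \<in> p l"
        using Card_order_cases[of \<mu> j k] \<mu>(1) mono[of j k] mono[of k j] jk by blast
      then show "y = z"
        using IH jk(1,2) by (auto simp: small_partial_def dest: single_valuedD)
    qed
    \<comment> \<open>Regularity of \<mu> enters here: fewer than \<mu> earlier stages, each of size
      less than \<mu>.\<close>
    moreover have "|q i| <o \<mu>"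
      unfolding q_def using \<mu> card_of_underS[OF _ i] IH
      by (intro card_of_UNION_ordLess_infinite_Field_regularCard) (auto simp: small_partial_def)
    moreover have "q i \<subseteq> Field \<mu> \<times> S"
      using IH unfolding q_def small_partial_def by blast
    ultimately show ?thesis
      by (simp add: small_partial_def)
  qed
  have p_small: "i \<in> Field \<mu> \<longrightarrow> small_partial \<mu> S (p i)" for i
  proof (induction i rule: wo_rel.well_order_induct[OF wo])
    case (1 i)
    show ?case
    proof
      assume i: "i \<in> Field \<mu>"
      have "small_partial \<mu> S (q i)"
        using 1 by (intro q_small i) (auto simp: underS_def Field_def)
      then show "small_partial \<mu> S (p i)"
        using E[OF i] i by (simp add: p_eq E'_def)
    qed
  qed
  have avoid: "\<not> extends a (p i)" if i: "i \<in> Field \<mu>" and "a \<in> A i" for a i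
  proof -
    have "small_partial \<mu> S (q i)"
      using p_small by (intro q_small i) (auto simp: underS_def Field_def)
    then show ?thesis
      using E[OF i] that by (simp add: p_eq E'_def)
  qed
  have unique: "y = z" if "i \<in> Field \<mu>" "k \<in> Field \<mu>" "(x, y) \<in> p i" "(x, z) \<in> p k" for i k x y z
  proof -
    have "\<exists>l\<in>{i, k}. (x, y) \<in> p l \<and> (x, z) \<in> p l"
      using Card_order_cases[of \<mu> i k] \<mu>(1) mono[of i k] mono[of k i] that by blast
    then show ?thesis
      using p_small that(1,2) by (auto simp: small_partial_def dest: single_valuedD)
  qed
  obtain s where s: "s \<in> S"
    using S by blast
  \<comment> \<open>The union of the chain, completed by the default value \<open>s\<close> at
    coordinates that no stage decides. The choice by \<open>SOME\<close> is forced by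
    \<open>unique\<close>.\<close>
  define a where "a = restrict (\<lambda>j. if \<exists>i\<in>Field \<mu>. \<exists>z. (j, z) \<in> p i
      then (SOME z. \<exists>i\<in>Field \<mu>. (j, z) \<in> p i) else s) (Field \<mu>)"
  have a: "a j = z" if "i \<in> Field \<mu>" "(j, z) \<in> p i" for i j z
  proof -
    have "j \<in> Field \<mu>"
      using p_small that by (auto simp: small_partial_def)
    moreover have "(SOME z. \<exists>i\<in>Field \<mu>. (j, z) \<in> p i) = z"
      using that unique by (intro some_equality) blast+
    ultimately show ?thesis
      using that by (auto simp: a_def)
  qed
  have "a \<in> Field \<mu> \<rightarrow>\<^sub>E S"
  proof (rule PiE_I)
    fix j assume j: "j \<in> Field \<mu>"
    show "a j \<in> S"
    proof (cases "\<exists>i\<in>Field \<mu>. \<exists>z. (j, z) \<in> p i")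
      case True
      then obtain i z where iz: "i \<in> Field \<mu>" "(j, z) \<in> p i"
        by blast
      then show ?thesis
        using a[OF iz] p_small by (auto simp: small_partial_def)
    next
      case False
      then show ?thesis
        using j s by (auto simp: a_def)
    qed
  qed (simp add: a_def)
  then obtain i where i: "i \<in> Field \<mu>" "a \<in> A i"
    using cover by blast
  moreover have "extends a (p i)"
    using a[OF i(1)] by (auto simp: extends_def)
  ultimately show False
    using avoid by blast
qed

text \<open>Evaluation at a coordinate \<open>i0\<close> where \<open>q\<close> is undefined sends
  the points of \<open>A\<close> extending \<open>q\<close> onto \<open>Z\<close>. Density makes
  this map open, and continuity makes the images of base elements small enough, so they form a base
  of \<open>Z\<close>.\<close>

lemma base_of_somewhere_dense_piece:
  assumes \<mu>: "Cinfinite \<mu>" and q: "small_partial \<mu> (topspace Z) q"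
    and A: "A \<subseteq> topspace (power_space (Field \<mu>) Z)"
    and dense: "\<And>p. small_partial \<mu> (topspace Z) p \<Longrightarrow> q \<subseteq> p \<Longrightarrow> \<exists>a\<in>A. extends a p"
    and \<B>: "is_base (subtopology (power_space (Field \<mu>) Z) A) \<B>"
  shows "\<exists>\<C>. is_base Z \<C> \<and> |\<C>| \<le>o |\<B>|"
proof -
  let ?P = "power_space (Field \<mu>) Z"
  have "\<exists>i0\<in>Field \<mu>. i0 \<notin> fst ` q"
  proof (rule ccontr)
    assume "\<not> ?thesis"
    then have "|Field \<mu>| \<le>o |fst ` q|"
      by (intro card_of_mono1) blast
    also have "|fst ` q| \<le>o |q|"
      by (rule card_of_image)
    also have "|q| <o \<mu>"
      using q by (simp add: small_partial_def)
    also have "\<mu> =o |Field \<mu>|"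
      using \<mu> card_of_Field_ordIso ordIso_symmetric by blast
    finally show False
      using ordLess_irreflexive by blast
  qed
  then obtain i0 where i0: "i0 \<in> Field \<mu>" "i0 \<notin> fst ` q"
    by blast
  \<comment> \<open>Density can be applied after prescribing finitely many further values compatible
    with \<open>q\<close>.\<close>
  have small: "small_partial \<mu> (topspace Z) (q \<union> (\<lambda>l. (l, b l)) ` J)"
    if J: "finite J" "J \<subseteq> Field \<mu>" "\<And>l. l \<in> J \<Longrightarrow> b l \<in> topspace Z"
      and q_b: "\<And>l z. l \<in> J \<Longrightarrow> (l, z) \<in> q \<Longrightarrow> b l = z" for J b
  proof -
    have "single_valued (q \<union> (\<lambda>l. (l, b l)) ` J)"
      using q q_b by (auto simp: single_valued_def small_partial_def)
    moreover have "|q \<union> (\<lambda>l. (l, b l)) ` J| <o \<mu>"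
      using q J(1) finite_ordLess_Cinfinite[OF \<mu>] \<mu>
      by (intro Un_Cinfinite_bound_strict) (auto simp: small_partial_def)
    ultimately show ?thesis
      using q J(2,3) by (auto simp: small_partial_def)
  qed
  define V where "V G = (\<lambda>a. a i0) ` {a \<in> G. extends a q}" for G
  have V_open: "openin Z (V G)" if G: "G \<in> \<B>" for G
  proof (subst openin_subopen, intro ballI)
    fix z assume "z \<in> V G"
    then obtain a where a: "a \<in> G" "extends a q" "z = a i0"
      by (auto simp: V_def)
    have "openin (subtopology ?P A) G"
      using \<B> G by (auto simp: is_base_def)
    then obtain W where W: "openin ?P W" "G = W \<inter> A"
      by (auto simp: openin_subtopology)
    have "a \<in> W"
      using W(2) a(1) by blast
    then obtain U where U: "finite {i \<in> Field \<mu>. U i \<noteq> topspace Z}" "\<forall>i\<in>Field \<mu>. openin Z (U i)"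
        "a \<in> Pi\<^sub>E (Field \<mu>) U" "Pi\<^sub>E (Field \<mu>) U \<subseteq> W"
      using W(1) unfolding openin_product_topology_alt by meson
    \<comment> \<open>Besides the coordinates restricted by the box, \<open>i0\<close> is included
      so that the value there can be prescribed.\<close>
    let ?J = "insert i0 {i \<in> Field \<mu>. U i \<noteq> topspace Z}"
    have "U i0 \<subseteq> V G"
    proof
      fix y assume y: "y \<in> U i0"
      \<comment> \<open>Changing \<open>a\<close> at \<open>i0\<close> may leave \<open>A\<close>.
        Density supplies a point \<open>c\<close> of \<open>A\<close> that agrees with
        \<open>b\<close> on \<open>?J\<close> and with \<open>q\<close>, and this is enough for
        \<open>c\<close> to stay in the box.\<close>
      define b where "b = a(i0 := y)"
      have b_U: "b l \<in> U l" if "l \<in> Field \<mu>" for l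
        using PiE_mem[OF U(3) that] y by (simp add: b_def)
      have UZ: "U l \<subseteq> topspace Z" if "l \<in> Field \<mu>" for l
        using U(2) that openin_subset by blast
      have "small_partial \<mu> (topspace Z) (q \<union> (\<lambda>l. (l, b l)) ` ?J)"
      proof (rule small)
        show "finite ?J" "?J \<subseteq> Field \<mu>"
          using U(1) i0(1) by auto
        show "b l \<in> topspace Z" if "l \<in> ?J" for l
          using b_U[of l] UZ[of l] that i0(1) by blast
        show "b l = z" if "(l, z) \<in> q" for l z
          using that i0(2) a(2) by (force simp: extends_def b_def)
      qed
      then obtain c where c: "c \<in> A" "extends c (q \<union> (\<lambda>l. (l, b l)) ` ?J)"
        using dense by blast
      have c_b: "c l = b l" if "l \<in> ?J" for l
        by (rule extendsD[OF c(2)]) (use that in blast)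
      have cP: "c \<in> Field \<mu> \<rightarrow>\<^sub>E topspace Z"
        using c(1) A by auto
      have "c l \<in> U l" if "l \<in> Field \<mu>" for l
      proof (cases "l \<in> ?J")
        case True
        then show ?thesis
          using c_b b_U[OF that] by simp
      next
        case False
        then show ?thesis
          using PiE_mem[OF cP that] that by simp
      qed
      then have "c \<in> Pi\<^sub>E (Field \<mu>) U"
        using cP by (simp add: PiE_iff)
      then have "c \<in> G"
        using U(4) W(2) c(1) by blast
      moreover have "extends c q"
        using c(2) by (auto simp: extends_def)
      moreover have "c i0 = y"
        using c_b[of i0] by (simp add: b_def)
      ultimately show "y \<in> V G"
        by (auto simp: V_def)
    qed
    moreover have "openin Z (U i0)" "z \<in> U i0"
      using U(2) PiE_mem[OF U(3) i0(1)] i0(1) a(3) by auto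
    ultimately show "\<exists>T. openin Z T \<and> z \<in> T \<and> T \<subseteq> V G"
      by blast
  qed
  have V_refine: "\<exists>G\<in>\<B>. z \<in> V G \<and> V G \<subseteq> U" if U: "openin Z U" "z \<in> U" for U z
  proof -
    have z: "z \<in> topspace Z"
      using U openin_subset by blast
    have "(i0, x) \<notin> q" for x
      using i0(2) by force
    then have "small_partial \<mu> (topspace Z) (q \<union> (\<lambda>l. (l, z)) ` {i0})"
      using i0(1) z by (intro small) simp_all
    from dense[OF this] obtain a where a: "a \<in> A" "extends a (q \<union> (\<lambda>l. (l, z)) ` {i0})"
      by blast
    let ?W = "{c \<in> topspace ?P. c i0 \<in> U}"
    have "openin ?P ?W"
      using U(1) i0(1) by (intro openin_continuous_map_preimage[OF continuous_map_product_projection])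
    then have "openin (subtopology ?P A) (?W \<inter> A)"
      by (auto simp: openin_subtopology)
    moreover have a_z: "a i0 = z" "extends a q"
      using a(2) by (auto simp: extends_def)
    then have "a \<in> ?W \<inter> A"
      using a(1) A U(2) by auto
    ultimately obtain G where G: "G \<in> \<B>" "a \<in> G" "G \<subseteq> ?W \<inter> A"
      using \<B> unfolding is_base_def by meson
    have "z \<in> V G" "V G \<subseteq> U"
      using G a_z by (auto simp: V_def)
    then show ?thesis
      using G(1) by blast
  qed
  have "is_base Z (V ` \<B>)"
    unfolding is_base_def
  proof (intro conjI ballI allI impI)
    show "openin Z W" if "W \<in> V ` \<B>" for W
      using that V_open by blast
    show "\<exists>W\<in>V ` \<B>. x \<in> W \<and> W \<subseteq> U" if "openin Z U \<and> x \<in> U" for U x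
      using V_refine[of U x] that by blast
  qed
  then show ?thesis
    using card_of_image[of V \<B>] by blast
qed

lemma power_space_not_union:
  assumes \<mu>: "Cinfinite \<mu>" "regularCard \<mu>"
    and Z: "topspace Z \<noteq> {}" "\<And>\<C>. is_base Z \<C> \<Longrightarrow> \<not> |\<C>| \<le>o \<mu>"
    and cover: "topspace (power_space (Field \<mu>) Z) = (\<Union>i\<in>Field \<mu>. A i)"
  shows "\<exists>i\<in>Field \<mu>. \<forall>\<B>. is_base (subtopology (power_space (Field \<mu>) Z) (A i)) \<B> \<longrightarrow> \<not> |\<B>| \<le>o \<mu>"
proof -
  obtain i q where i: "i \<in> Field \<mu>" "small_partial \<mu> (topspace Z) q"
      "\<forall>p. small_partial \<mu> (topspace Z) p \<and> q \<subseteq> p \<longrightarrow> (\<exists>a\<in>A i. extends a p)"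
    using exists_somewhere_dense_piece[OF \<mu> Z(1), of A] cover by auto
  have "\<not> |\<B>| \<le>o \<mu>" if \<B>: "is_base (subtopology (power_space (Field \<mu>) Z) (A i)) \<B>" for \<B>
  proof
    assume le: "|\<B>| \<le>o \<mu>"
    have "A i \<subseteq> topspace (power_space (Field \<mu>) Z)"
      using cover i(1) by blast
    then obtain \<C> where "is_base Z \<C>" "|\<C>| \<le>o |\<B>|"
      using base_of_somewhere_dense_piece[OF \<mu>(1) i(2) _ _ \<B>] i(3) by meson
    then show False
      using Z(2) le ordLeq_transitive by blast
  qed
  then show ?thesis
    using i(1) by blast
qed

subsection \<open>Homeomorphic copies\<close>

lemma is_base_homeomorphic_image:
  assumes f: "homeomorphic_map X Y f" and \<B>: "is_base X \<B>"
  shows "is_base Y ((`) f ` \<B>)"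
proof -
  obtain g where g: "homeomorphic_maps X Y f g"
    using f by (auto simp: homeomorphic_map_maps)
  show ?thesis
    unfolding is_base_def
  proof (intro conjI ballI allI impI)
    show "openin Y V" if "V \<in> (`) f ` \<B>" for V
      using that \<B> homeomorphic_imp_open_map[OF f] by (auto simp: is_base_def open_map_def)
    fix U y assume U: "openin Y U \<and> y \<in> U"
    then have y: "y \<in> topspace Y" "U \<subseteq> topspace Y"
      using openin_subset by blast+
    have "openin X {x \<in> topspace X. f x \<in> U}"
      using U homeomorphic_imp_continuous_map[OF f] by (blast intro: openin_continuous_map_preimage)
    moreover have "g y \<in> topspace X" "f (g y) = y"
      using g y(1) by (auto simp: homeomorphic_maps_def continuous_map_def)
    ultimately obtain V where "V \<in> \<B>" "g y \<in> V" "V \<subseteq> {x \<in> topspace X. f x \<in> U}"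
      using \<B> U unfolding is_base_def by (metis (mono_tags, lifting) mem_Collect_eq)
    then show "\<exists>V\<in>(`) f ` \<B>. y \<in> V \<and> V \<subseteq> U"
      using \<open>f (g y) = y\<close> by (intro bexI[of _ "f ` V"]) force+
  qed
qed

lemma is_local_base_homeomorphic_image:
  assumes f: "homeomorphic_map X Y f" and \<B>: "is_local_base X x \<B>" and x: "x \<in> topspace X"
  shows "is_local_base Y (f x) ((`) f ` \<B>)"
  unfolding is_local_base_def
proof (intro conjI ballI allI impI)
  fix V assume "V \<in> (`) f ` \<B>"
  then show "openin Y V" "f x \<in> V"
    using \<B> homeomorphic_imp_open_map[OF f] by (auto simp: is_local_base_def open_map_def)
next
  fix U assume U: "openin Y U \<and> f x \<in> U"
  have "openin X {x \<in> topspace X. f x \<in> U}"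
    using U homeomorphic_imp_continuous_map[OF f] by (blast intro: openin_continuous_map_preimage)
  then obtain V where "V \<in> \<B>" "V \<subseteq> {x \<in> topspace X. f x \<in> U}"
    using \<B> U x unfolding is_local_base_def by (metis (mono_tags, lifting) mem_Collect_eq)
  then show "\<exists>V\<in>(`) f ` \<B>. V \<subseteq> U"
    by blast
qed

lemma is_network_homeomorphic_image:
  assumes f: "homeomorphic_map X Y f" and \<N>: "is_network X \<N>"
  shows "is_network Y ((`) f ` \<N>)"
proof -
  have fX: "f ` topspace X = topspace Y"
    using f by (rule homeomorphic_imp_surjective_map)
  show ?thesis
    unfolding is_network_def
  proof (intro conjI ballI allI impI)
    show "V \<subseteq> topspace Y" if "V \<in> (`) f ` \<N>" for V
      using that \<N> fX unfolding is_network_def by blast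
    fix U y assume U: "openin Y U \<and> y \<in> U"
    then obtain x where x: "x \<in> topspace X" "y = f x"
      using openin_subset fX by blast
    have "openin X {x \<in> topspace X. f x \<in> U}"
      using U homeomorphic_imp_continuous_map[OF f] by (blast intro: openin_continuous_map_preimage)
    then obtain V where "V \<in> \<N>" "x \<in> V" "V \<subseteq> {x \<in> topspace X. f x \<in> U}"
      using \<N> U x unfolding is_network_def by (metis (mono_tags, lifting) mem_Collect_eq)
    then show "\<exists>V\<in>(`) f ` \<N>. y \<in> V \<and> V \<subseteq> U"
      using x(2) by blast
  qed
qed

text \<open>The topology is pulled back along the inverse of an injection, restricted to its image.
  This moves a space of functions to the type prescribed for \<open>Y\<close>.\<close>

lemma exists_homeomorphic_copy:
  fixes X :: "'c topology"
  assumes le: "|topspace X| \<le>o |UNIV :: 'd set|"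
  shows "\<exists>(Y :: 'd topology) f. homeomorphic_map X Y f"
proof -
  obtain f :: "'c \<Rightarrow> 'd" where f: "inj_on f (topspace X)"
    using le unfolding card_of_ordLeq[symmetric] by blast
  define g where "g = inv_into (topspace X) f"
  define Y where "Y = pullback_topology (f ` topspace X) g X"
  have gf: "g (f x) = x" if "x \<in> topspace X" for x
    using f that by (simp add: g_def)
  have topY: "topspace Y = f ` topspace X"
    using gf by (auto simp: Y_def topspace_pullback_topology)
  have "continuous_map X Y f"
    unfolding continuous_map_def
  proof (intro conjI allI impI)
    show "f \<in> topspace X \<rightarrow> topspace Y"
      using topY by blast
    fix U assume "openin Y U"
    then obtain V where V: "openin X V" "U = g -` V \<inter> f ` topspace X"
      by (auto simp: Y_def openin_pullback_topology)
    have "f x \<in> U \<longleftrightarrow> x \<in> V" if "x \<in> topspace X" for x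
      using that gf by (simp add: V(2))
    then have "{x \<in> topspace X. f x \<in> U} = V"
      using openin_subset[OF V(1)] by blast
    then show "openin X {x \<in> topspace X. f x \<in> U}"
      using V(1) by simp
  qed
  moreover have "continuous_map Y X g"
    unfolding continuous_map_def
  proof (intro conjI allI impI)
    show "g \<in> topspace Y \<rightarrow> topspace X"
      using topY gf by auto
    fix V assume "openin X V"
    then have "openin Y (g -` V \<inter> f ` topspace X)"
      by (auto simp: Y_def openin_pullback_topology)
    moreover have "{y \<in> topspace Y. g y \<in> V} = g -` V \<inter> f ` topspace X"
      using topY by auto
    ultimately show "openin Y {y \<in> topspace Y. g y \<in> V}"
      by simp
  qed
  moreover have "f (g y) = y" if "y \<in> topspace Y" for y
    using that gf topY by auto
  ultimately have "homeomorphic_maps X Y f g"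
    using gf by (simp add: homeomorphic_maps_def)
  then show ?thesis
    using homeomorphic_map_maps by blast
qed

subsection \<open>Logarithms of successor cardinals\<close>

lemma card_of_Pow_ordLeq:
  assumes "|A| \<le>o |B|"
  shows "|Pow A| \<le>o |Pow B|"
proof -
  obtain f where f: "inj_on f A" "f ` A \<subseteq> B"
    using assms unfolding card_of_ordLeq[symmetric] by blast
  have "inj_on ((`) f) (Pow A)"
    using f(1) by (rule inj_on_image_Pow)
  moreover have "(`) f ` Pow A \<subseteq> Pow B"
    using f(2) by blast
  ultimately show ?thesis
    unfolding card_of_ordLeq[symmetric] by blast
qed

lemma ctwo_cexp_Pow: "|Pow (Field p)| =o ctwo ^c p"
  unfolding ctwo_def cexp_def Field_card_of by (rule card_of_Pow_Func)

text \<open>\<open>clog\<close> and \<open>character\<close> minimise over cardinals on one fixed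
  type; an injection provides a copy of \<mu> on that type to compare with.\<close>

lemma card_of_inj_image_Field:
  assumes "Card_order \<mu>" "inj f"
  shows "\<mu> =o |f ` Field \<mu>|"
proof -
  have "|Field \<mu>| =o |f ` Field \<mu>|"
    using assms(2) by (intro card_of_ordIsoI[of f]) (simp add: bij_betw_def inj_on_def)
  then show ?thesis
    using card_of_Field_ordIso[OF assms(1)] ordIso_symmetric ordIso_transitive by blast
qed

text \<open>The first two bounds come from minimality of the logarithm, tested against \<mu> itself
  and against initial segments of \<nu>. The last is its defining inequality.\<close>

lemma clog_cardSuc:
  fixes \<mu> :: "'a rel"
  defines "\<nu> \<equiv> clog (cardSuc \<mu>)"
  assumes \<mu>: "Cinfinite \<mu>" and \<nu>: "Cinfinite \<nu>"
  shows clog_cardSuc_le: "|Field \<nu>| \<le>o \<mu>"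
    and clog_cardSuc_under: "n \<in> Field \<nu> \<Longrightarrow> |Pow (under \<nu> n)| \<le>o \<mu>"
    and clog_cardSuc_Pow: "\<mu> <o |Pow (Field \<nu>)|"
proof -
  have card: "Card_order \<mu>"
    using \<mu> by simp
  note spec = clog_spec[OF cardSuc_Card_order[OF card], folded \<nu>_def]
  show "|Field \<nu>| \<le>o \<mu>"
  proof -
    let ?\<kappa> = "|(\<lambda>a. {a}) ` Field \<mu>|"
    have iso: "\<mu> =o ?\<kappa>"
      by (intro card_of_inj_image_Field card) (simp add: inj_def)
    then have "\<mu> <o ctwo ^c ?\<kappa>"
      using ordLess_ctwo_cexp[OF card_of_Card_order] ordIso_ordLess_trans by blast
    then have "cardSuc \<mu> \<le>o ctwo ^c ?\<kappa>"
      by (rule cardSuc_least[OF card Card_order_cexp])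
    then have "\<nu> \<le>o ?\<kappa>"
      by (rule spec(3)[OF card_of_Card_order])
    then have "\<nu> \<le>o \<mu>"
      using iso ordIso_symmetric ordLeq_ordIso_trans by blast
    then show ?thesis
      using card_of_Field_ordIso[OF spec(1)] ordIso_ordLeq_trans by blast
  qed
  show "|Pow (under \<nu> n)| \<le>o \<mu>" if n: "n \<in> Field \<nu>"
  proof -
    \<comment> \<open>A closed initial segment has just one point more than the open one, so it is
      still smaller than the infinite cardinal \<nu>.\<close>
    have "under \<nu> n = underS \<nu> n \<union> {n}"
      using n spec(1) unfolding under_def underS_def card_order_on_def order_on_defs
      by (auto dest: refl_onD)
    moreover have "|underS \<nu> n \<union> {n}| <o \<nu>"
      using \<nu> card_of_underS[OF spec(1) n] finite_ordLess_Cinfinite[OF \<nu>, of "{n}"]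
      by (intro Un_Cinfinite_bound_strict) simp_all
    ultimately have "\<not> \<nu> \<le>o |under \<nu> n|"
      using not_ordLess_ordLeq[of "|underS \<nu> n \<union> {n}|" \<nu>] by simp
    then have "\<not> cardSuc \<mu> \<le>o ctwo ^c |under \<nu> n|"
      using spec(3)[OF card_of_Card_order] by blast
    then have "ctwo ^c |under \<nu> n| <o cardSuc \<mu>"
      using not_ordLeq_iff_ordLess[OF card_order_on_well_order_on[OF Card_order_cexp]
          card_order_on_well_order_on[OF cardSuc_Card_order[OF card]]] by blast
    then have "ctwo ^c |under \<nu> n| \<le>o \<mu>"
      using cardSuc_ordLeq_ordLess[OF card Card_order_cexp] by blast
    then show ?thesis
      using ordIso_ordLeq_trans[OF ctwo_cexp_Pow[of "|under \<nu> n|"]] by (simp add: Field_card_of)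
  qed
  show "\<mu> <o |Pow (Field \<nu>)|"
    by (rule ordLess_ordIso_trans[OF ordLess_ordLeq_trans[OF cardSuc_greater[OF card] spec(2)]
          ordIso_symmetric[OF ctwo_cexp_Pow]])
qed

text \<open>If points of \<open>Z\<close> are coded as subsets of \<open>I\<close>, a function into
  \<open>Z\<close> is coded by a subset of \<open>I \<times> I\<close>, whose section over
  \<open>i\<close> is the code of its value. As \<open>I\<close> is infinite,
  \<open>I \<times> I\<close> is no larger than \<open>I\<close>.\<close>

lemma power_space_le:
  fixes Z :: "'z topology" and I :: "'a set"
  assumes I: "infinite I" and Z: "|topspace Z| \<le>o |Pow I|"
  shows "|topspace (power_space I Z)| \<le>o |UNIV :: 'a set set|"
proof -
  obtain g where g: "inj_on g (topspace Z)" "g ` topspace Z \<subseteq> Pow I"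
    using Z unfolding card_of_ordLeq[symmetric] by blast
  define h where "h c = (SIGMA i:I. g (c i))" for c
  have "inj_on h (I \<rightarrow>\<^sub>E topspace Z)"
  proof (rule inj_onI)
    fix c d assume c: "c \<in> I \<rightarrow>\<^sub>E topspace Z" and d: "d \<in> I \<rightarrow>\<^sub>E topspace Z" and "h c = h d"
    then have "g (c i) = g (d i)" if "i \<in> I" for i
      using that unfolding h_def by blast
    then have "c i = d i" if "i \<in> I" for i
      using inj_onD[OF g(1), of "c i" "d i"] PiE_mem[OF c that] PiE_mem[OF d that] that by blast
    then show "c = d"
      by (rule PiE_ext[OF c d])
  qed
  moreover have "h ` (I \<rightarrow>\<^sub>E topspace Z) \<subseteq> Pow (I \<times> I)"
  proof (intro image_subsetI PowI)
    fix c assume c: "c \<in> I \<rightarrow>\<^sub>E topspace Z"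
    then have "g (c i) \<subseteq> I" if "i \<in> I" for i
      using g(2) PiE_mem[OF c that] by blast
    then show "h c \<subseteq> I \<times> I"
      by (auto simp: h_def)
  qed
  ultimately have "|topspace (power_space I Z)| \<le>o |Pow (I \<times> I)|"
    unfolding card_of_ordLeq[symmetric] topspace_product_topology by blast
  also have "|Pow (I \<times> I)| \<le>o |Pow I|"
    using I by (intro card_of_Pow_ordLeq card_of_Sigma_ordLeq_infinite) (auto intro: ordIso_imp_ordLeq card_of_refl)
  also have "|Pow I| \<le>o |UNIV :: 'a set set|"
    by (intro card_of_mono1) simp
  finally show ?thesis .
qed

section \<open>The power of the bow-tie space, transferred to subsets of the index type\<close>

theorem theorem4p3:
  fixes \<mu> :: "'a rel"
  assumes "regular_cardinal \<mu>"
    and "regular_cardinal (clog (cardSuc \<mu>))"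
  shows "\<exists>Y :: 'a set topology.
           Hausdorff_space Y \<and> zero_dimensional Y \<and>
           character Y *c network_weight Y \<le>o \<mu> \<and>
           \<not> (\<exists>A :: 'a \<Rightarrow> 'a set set.
                topspace Y = (\<Union>i\<in>Field \<mu>. A i) \<and>
                (\<forall>i\<in>Field \<mu>. weight (subtopology Y (A i)) \<le>o \<mu>))"
proof -
  let ?\<nu> = "clog (cardSuc \<mu>)"
  have \<mu>: "Cinfinite \<mu>" "regularCard \<mu>" and \<nu>: "Cinfinite ?\<nu>"
    using assms by (auto simp: regular_cardinal_def)
  note le = clog_cardSuc[OF \<mu>(1) \<nu>]
  interpret bow_tie ?\<nu>
  proof
    show "Linear_order ?\<nu>"
      using \<nu> by (auto simp: card_order_on_def order_on_defs)
    show "Field ?\<nu> \<noteq> {}"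
      using \<nu> by (auto simp: cinfinite_def)
  qed
  let ?P = "power_space (Field \<mu>) space"
  have I: "|Field \<mu>| \<le>o \<mu>"
    using \<mu>(1) card_of_Field_ordIso ordIso_imp_ordLeq by blast
  have inf: "infinite (Field \<mu>)"
    using \<mu>(1) by (simp add: cinfinite_def)
  \<comment> \<open>The branches number at most \<open>2\<close> to the power \<nu>, with \<nu> at
    most \<mu>, and the nodes at most \<mu>.\<close>
  have "|topspace space| \<le>o |Pow (Field \<mu>)|"
  proof -
    have "|Field ?\<nu>| \<le>o |Field \<mu>|"
      using le(1) \<mu>(1) card_of_Field_ordIso ordIso_symmetric ordLeq_ordIso_trans by blast
    then have "|Pow (Field ?\<nu>)| \<le>o |Pow (Field \<mu>)|"
      by (rule card_of_Pow_ordLeq)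
    moreover have "\<mu> \<le>o |Pow (Field \<mu>)|"
      using \<mu>(1) card_of_Pow card_of_Field_ordIso ordIso_symmetric ordIso_ordLess_trans
        ordLess_imp_ordLeq by metis
    then have "|SIGMA m:Field ?\<nu>. Pow (under ?\<nu> m)| \<le>o |Pow (Field \<mu>)|"
      using nodes_le[OF \<mu>(1) le(1,2)] ordLeq_transitive by blast
    moreover have "Cinfinite |Pow (Field \<mu>)|"
      using inf by (simp add: cinfinite_def Field_card_of card_of_card_order_on finite_Pow_iff)
    ultimately show ?thesis
      unfolding topspace_space carrier_def by (intro Un_Cinfinite_bound ordLeq_image)
  qed
  then obtain Y :: "'a set topology" and f where f: "homeomorphic_map ?P Y f"
    using exists_homeomorphic_copy[OF power_space_le[OF inf]] by blast
  then have homeo: "?P homeomorphic_space Y"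
    using homeomorphic_map_imp_homeomorphic_space by blast
  have "Hausdorff_space ?P"
    using Hausdorff by (simp add: Hausdorff_space_product_topology)
  then have Y_Hausdorff: "Hausdorff_space Y"
    using homeomorphic_Hausdorff_space[OF homeo] by blast
  have "zero_dimensional space"
    unfolding zero_dimensional_def is_base_def
    using clopen_base by (intro exI[of _ "{V. openin space V \<and> closedin space V}"]) blast
  then have "zero_dimensional ?P"
    by (rule power_space_zero_dimensional)
  then have Y_zero_dim: "zero_dimensional Y"
    using homeomorphic_space_dimension_le[OF homeo] by (simp add: zero_dimensional_iff_dim_le_0)
  have fP: "f ` topspace ?P = topspace Y"
    using f by (rule homeomorphic_imp_surjective_map)
  have "character_at Y y \<le>o \<mu>" if y: "y \<in> topspace Y" for y
  proof -
    obtain x where x: "x \<in> topspace ?P" "y = f x"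
      using y[folded fP] by blast
    have "\<exists>\<B>. is_local_base space z \<B> \<and> |\<B>| \<le>o \<mu>" if "z \<in> topspace space" for z
      using local_base_le[OF \<mu>(1) le(1)] that by (simp add: topspace_space)
    then obtain \<B> where \<B>: "is_local_base ?P x \<B>" "|\<B>| \<le>o \<mu>"
      using power_space_local_base[OF \<mu>(1) I _ x(1)] by blast
    have "character_at Y y \<le>o |(`) f ` \<B>|"
      unfolding x(2) by (rule character_at_spec(3)[OF is_local_base_homeomorphic_image[OF f \<B>(1) x(1)]])
    then show ?thesis
      using ordLeq_transitive ordLeq_image[OF \<B>(2)] by blast
  qed
  \<comment> \<open>Doubled singletons give a copy of \<mu> on the type over which
    \<open>character Y\<close> is minimised.\<close>
  moreover have iso: "\<mu> =o |(\<lambda>a. {{a}}) ` Field \<mu>|"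
    using \<mu>(1) by (intro card_of_inj_image_Field) (auto simp: inj_def)
  ultimately have "\<forall>y\<in>topspace Y. character_at Y y \<le>o |(\<lambda>a. {{a}}) ` Field \<mu>|"
    using ordLeq_ordIso_trans by blast
  then have "character Y \<le>o |(\<lambda>a. {{a}}) ` Field \<mu>|"
    by (rule character_spec(3)[OF card_of_Card_order])
  then have Y_character: "character Y \<le>o \<mu>"
    using iso ordIso_symmetric ordLeq_ordIso_trans by blast
  obtain \<N> where "is_network space \<N>" "|\<N>| \<le>o \<mu>"
    using network_le[OF \<mu>(1) le(1,2)] by blast
  then obtain \<M> where \<M>: "is_network ?P \<M>" "|\<M>| \<le>o \<mu>"
    using power_space_network[OF \<mu>(1) I] by blast
  have "network_weight Y \<le>o |(`) f ` \<M>|"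
    by (rule network_weight_spec(3)[OF is_network_homeomorphic_image[OF f \<M>(1)]])
  then have Y_network: "network_weight Y \<le>o \<mu>"
    using ordLeq_image[OF \<M>(2)] ordLeq_transitive by blast
  have "\<not> (topspace Y = (\<Union>i\<in>Field \<mu>. A i) \<and>
      (\<forall>i\<in>Field \<mu>. weight (subtopology Y (A i)) \<le>o \<mu>))" for A
  proof (intro notI, elim conjE)
    assume cover: "topspace Y = (\<Union>i\<in>Field \<mu>. A i)"
      and small: "\<forall>i\<in>Field \<mu>. weight (subtopology Y (A i)) \<le>o \<mu>"
    \<comment> \<open>The pieces are pulled back to the power. A small base of \<open>A i\<close>
      would then be carried by the inverse homeomorphism to one of \<open>A' i\<close>.\<close>
    define A' where "A' i = {x \<in> topspace ?P. f x \<in> A i}" for i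
    have "topspace ?P = (\<Union>i\<in>Field \<mu>. A' i)"
      using fP cover by (auto simp: A'_def)
    moreover have "topspace space \<noteq> {}"
      by (auto simp: topspace_space carrier_def)
    ultimately obtain i where i: "i \<in> Field \<mu>"
        "\<And>\<B>. is_base (subtopology ?P (A' i)) \<B> \<Longrightarrow> \<not> |\<B>| \<le>o \<mu>"
      using power_space_not_union[OF \<mu>, of space A'] weight_gt[OF \<mu>(1) le] by blast
    obtain g where g: "homeomorphic_maps ?P Y f g"
      using f by (auto simp: homeomorphic_map_maps)
    have "f ` (topspace ?P \<inter> A' i) = topspace Y \<inter> A i"
      unfolding A'_def fP[symmetric] by blast
    then have "homeomorphic_maps (subtopology ?P (A' i)) (subtopology Y (A i)) f g"
      using homeomorphic_maps_subtopologies[OF g] by blast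
    then have g': "homeomorphic_map (subtopology Y (A i)) (subtopology ?P (A' i)) g"
      by (simp add: homeomorphic_maps_map)
    obtain \<B> where \<B>: "is_base (subtopology Y (A i)) \<B>" "|\<B>| =o weight (subtopology Y (A i))"
      using weight_spec(2) by blast
    then have "|\<B>| \<le>o \<mu>"
      using small i(1) ordIso_ordLeq_trans by blast
    then show False
      using i(2)[OF is_base_homeomorphic_image[OF g' \<B>(1)]] ordLeq_image by blast
  qed
  moreover have "character Y *c network_weight Y \<le>o \<mu>"
    by (rule cprod_cinfinite_bound[OF Y_character Y_network character_spec(1) network_weight_spec(1) \<mu>(1)])
  ultimately show ?thesis
    using Y_Hausdorff Y_zero_dim by blast
qed

end
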